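(* Suppose that $B(z)$ is a Blaschke product with Property $\mathfrak{B}$. Let $z_0\in\mathbb{D}$. Then $z_0$ must be a common point of the boundaries of exactly $m$ (possibly infinitely many) distinct connected components of the level set $\{z\in\mathbb{D}:|B(z)|<|B(z_0)|\}$. When $z_0$ is a critical point of order $n-1$ for $B(z)$, i.e. $B^{(k)}(z_0)=0$ for $k=1,\ldots,n-1$ and $B^{(n)}(z_0)\neq 0$, we have $n=m$.
   Context: $\mathbb{D}$ is the open unit disk in $\mathbb{C}$. An inner function is a bounded analytic function on $\mathbb{D}$ with unimodular radial limits almost everywhere on $\partial\mathbb{D}$. A Blaschke product is an inner function of the form $B(z)=\lambda z^{p}\prod_{j}\frac{|\alpha_{j}|}{\alpha_{j}}\frac{\alpha_{j}-z}{1-\overline{\alpha_{j}}z}$, where $p$ is a nonnegative integer, $|\lambda|=1$, and $\{\alpha_j\}$ is a (finite or infinite) sequence of points in $\mathbb{D}\setminus\{0\}$ with $\sum_j(1-|\alpha_j|)<\infty$. An inner function $u$ has Property $\mathfrak{B}$ if for every $\theta\in(0,1)$ the closure of each connected component of the level set $\{z\in\mathbb{D}:|u(z)|<\theta\}$ is contained in $\mathbb{D}$.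
   Formalization: The claim n=m is stated only when B(z_0)≠0, and m≥1 only when moreover B is nonconstant: at a zero of B the level set is empty, so m=0 while n≥1 (e.g. B(z)=z, z_0=0), and for constant B the level set is also empty. *)

theory Defs
  imports "HOL-Complex_Analysis.Complex_Analysis" "HOL-Library.Extended_Nat"
begin

text \<open>The radial limits are parametrised by the angle; the exceptional set of angles is
  Lebesgue-null in the whole line, which by periodicity is the same as arc-length-null on
  the circle.\<close>

definition inner_function :: "(complex \<Rightarrow> complex) \<Rightarrow> bool" where
  "inner_function u \<longleftrightarrow>
     u holomorphic_on ball 0 1 \<and> bounded (u ` ball 0 1) \<and>
     (AE t in lborel. \<exists>L. cmod L = 1 \<and>
        ((\<lambda>r. u (complex_of_real r * cis t)) \<longlongrightarrow> L) (at_left 1))"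

definition blaschke_factor :: "complex \<Rightarrow> complex \<Rightarrow> complex" where
  "blaschke_factor a z = complex_of_real (cmod a) / a * ((a - z) / (1 - cnj a * z))"

text \<open>The sequence of nonzero zeros is \<open>\<alpha> j\<close> for \<open>enat j < N\<close>: it is finite of length \<open>N\<close>
  (possibly empty), or infinite when \<open>N = \<infinity>\<close>. Points may repeat. Under the summability
  condition the product converges, in the sense of \<open>convergent_prod\<close>, at every point of
  the disk, including the zeros.\<close>

definition blaschke_product :: "(complex \<Rightarrow> complex) \<Rightarrow> bool" where
  "blaschke_product B \<longleftrightarrow>
     inner_function B \<and>
     (\<exists>(c::complex) (p::nat) (N::enat) (\<alpha>::nat \<Rightarrow> complex).
        cmod c = 1 \<and>
        (\<forall>j. enat j < N \<longrightarrow> \<alpha> j \<in> ball 0 1 - {0}) \<and>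
        summable (\<lambda>j. if enat j < N then 1 - cmod (\<alpha> j) else 0) \<and>
        (\<forall>z\<in>ball 0 1.
           B z = c * z ^ p * (\<Prod>j. if enat j < N then blaschke_factor (\<alpha> j) z else 1)))"

definition sublevel_set :: "(complex \<Rightarrow> complex) \<Rightarrow> real \<Rightarrow> complex set" where
  "sublevel_set u \<theta> = {z \<in> ball 0 1. cmod (u z) < \<theta>}"

definition property_B :: "(complex \<Rightarrow> complex) \<Rightarrow> bool" where
  "property_B u \<longleftrightarrow>
     (\<forall>\<theta>\<in>{0<..<1}. \<forall>C\<in>components (sublevel_set u \<theta>). closure C \<subseteq> ball 0 1)"

text \<open>For \<open>d = 0\<close> this says that \<open>z0\<close> is not a critical point in the usual sense.\<close>

definition critical_point_of_order :: "(complex \<Rightarrow> complex) \<Rightarrow> complex \<Rightarrow> nat \<Rightarrow> bool" where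
  "critical_point_of_order f z0 d \<longleftrightarrow>
     (\<forall>k\<in>{1..d}. (deriv ^^ k) f z0 = 0) \<and> (deriv ^^ Suc d) f z0 \<noteq> 0"

definition ecard :: "'a set \<Rightarrow> enat" where
  "ecard S = (if finite S then enat (card S) else \<infinity>)"

end

theory Submission
  imports Defs
begin

text \<open>In a suitable coordinate \<open>w\<close> at a critical point \<open>z0\<close> of order \<open>n - 1\<close>, the inequality
  \<open>cmod f < cmod (f z0)\<close> reads \<open>Re (w ^ n) < 0\<close>, so it cuts out \<open>n\<close> sectors, each marked by one
  root of \<open>a ^ n = - \<rho> ^ n\<close>. A component has \<open>z0\<close> on its boundary iff it contains a sector, and
  by the Jordan curve theorem and the maximum principle it cannot contain two.\<close>

text \<open>The obstacle is global: two sectors that are disjoint near \<open>z0\<close> might be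
  joined by a detour far away. On the punctured plane this happens for
  \<open>exp (z + 1 / z)\<close> at \<open>z0 = 1\<close>: there \<open>n = 2\<close>, yet both
  sectors belong to the one component that contains the unit circle without \<open>1\<close>. Simple
  connectivity of the domain excludes this, because the inside of a Jordan curve then stays where
  \<open>f\<close> is holomorphic. The case \<open>f z0 = 0\<close> is set apart because the
  sublevel set is then empty, whatever the order of the zero. For \<open>f z0 \<noteq> 0\<close> the
  count is the order to which \<open>f - f z0\<close> vanishes at \<open>z0\<close>.\<close>

section \<open>Local form of the modulus near a critical point\<close>

lemma cmod_compare_Cayley:
  assumes "q * (x + c) = x - c" "x + c \<noteq> 0"
  shows "cmod x < cmod c \<longleftrightarrow> Re q < 0" "cmod c < cmod x \<longleftrightarrow> 0 < Re q"
proof -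
  \<comment> \<open>The cross terms \<open>x * cnj c - c * cnj x\<close> of the product are purely
    imaginary.\<close>
  have "(cmod x)\<^sup>2 - (cmod c)\<^sup>2 = Re ((x - c) * cnj (x + c))"
    unfolding cmod_power2 by (simp add: algebra_simps power2_eq_square)
  also have "(x - c) * cnj (x + c) = q * of_real ((cmod (x + c))\<^sup>2)"
    using assms(1) by (metis complex_norm_square mult.assoc)
  finally have eq: "(cmod x)\<^sup>2 - (cmod c)\<^sup>2 = Re q * (cmod (x + c))\<^sup>2"
    by simp
  have pos: "(cmod (x + c))\<^sup>2 > 0"
    using assms(2) by simp
  have "cmod x < cmod c \<longleftrightarrow> (cmod x)\<^sup>2 - (cmod c)\<^sup>2 < 0"
    by (simp flip: not_le)
  then show "cmod x < cmod c \<longleftrightarrow> Re q < 0"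
    unfolding eq using pos by (simp add: mult_less_0_iff)
  have "cmod c < cmod x \<longleftrightarrow> (cmod x)\<^sup>2 - (cmod c)\<^sup>2 > 0"
    by (simp flip: not_le)
  then show "cmod c < cmod x \<longleftrightarrow> 0 < Re q"
    unfolding eq using pos by (simp add: zero_less_mult_iff)
qed

lemma holomorphic_nth_root_ball:
  fixes g :: "complex \<Rightarrow> complex"
  assumes "g holomorphic_on ball a e" "\<And>z. z \<in> ball a e \<Longrightarrow> g z \<noteq> 0" "0 < n"
  obtains h where "h holomorphic_on ball a e" "\<And>z. z \<in> ball a e \<Longrightarrow> h z ^ n = g z"
proof -
  have "simply_connected (ball a e)"
    by (simp add: convex_imp_simply_connected)
  then obtain l where l: "l holomorphic_on ball a e" "\<And>z. z \<in> ball a e \<Longrightarrow> g z = exp (l z)"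
    using assms(1,2) simply_connected_eq_holomorphic_log[of "ball a e"] by (metis open_ball)
  show thesis
  proof
    show "(\<lambda>z. exp (l z / of_nat n)) holomorphic_on ball a e"
      using l(1) assms(3) by (intro holomorphic_intros) auto
    show "exp (l z / of_nat n) ^ n = g z" if "z \<in> ball a e" for z
      using l(2)[OF that] assms(3) by (simp flip: exp_of_nat_mult)
  qed
qed

lemma arc_inj_continuous_image:
  assumes "arc p" "continuous_on (path_image p) f" "inj_on f (path_image p)"
  shows "arc (f \<circ> p)"
  using assms by (auto simp: arc_def path_image_def intro: path_continuous_image comp_inj_on)

text \<open>Only topology is asked of \<open>\<phi>\<close>: continuity and injectivity already
  carry arcs to arcs and, by invariance of domain, open sets to open sets. \<open>less\<close>
  places the sectors in the sublevel set; \<open>greater\<close> bounds \<open>cmod f\<close> on the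
  rays and supplies the point that violates the maximum principle.\<close>

locale sector_chart =
  fixes f :: "complex \<Rightarrow> complex" and S :: "complex set" and z0 :: complex
    and n :: nat and r :: real and \<phi> :: "complex \<Rightarrow> complex"
  assumes n_pos: "0 < n" and r_pos: "0 < r"
    and cont: "continuous_on (ball 0 r) \<phi>"
    and inj: "inj_on \<phi> (ball 0 r)"
    and into: "\<And>w. w \<in> ball 0 r \<Longrightarrow> \<phi> w \<in> S"
    and zero: "\<phi> 0 = z0"
    and less: "\<And>w. w \<in> ball 0 r \<Longrightarrow> cmod (f (\<phi> w)) < cmod (f z0) \<longleftrightarrow> Re (w ^ n) < 0"
    and greater: "\<And>w. w \<in> ball 0 r \<Longrightarrow> cmod (f z0) < cmod (f (\<phi> w)) \<longleftrightarrow> 0 < Re (w ^ n)"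

text \<open>The Cayley transform \<open>(f - f z0) / (f + f z0)\<close> sends \<open>cmod f < cmod (f z0)\<close> to the left
  half plane and vanishes at \<open>z0\<close> to order \<open>n\<close>; the chart inverts its \<open>n\<close>-th root.\<close>

lemma sector_chart_exists:
  assumes f: "f holomorphic_on S" and S: "open S" "z0 \<in> S" and nz: "f z0 \<noteq> 0" and n: "0 < n"
    and dnz: "(deriv ^^ n) f z0 \<noteq> 0" and dz: "\<And>k. 0 < k \<Longrightarrow> k < n \<Longrightarrow> (deriv ^^ k) f z0 = 0"
  obtains r \<phi> where "sector_chart f S z0 n r \<phi>"
proof -
  define c where "c = f z0"
  obtain g e1 where g: "0 < e1" "g holomorphic_on ball z0 e1"
      "\<And>w. w \<in> ball z0 e1 \<Longrightarrow> f w - f z0 = (w - z0) ^ n * g w"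
      "\<And>w. w \<in> ball z0 e1 \<Longrightarrow> g w \<noteq> 0"
    by (rule holomorphic_factor_order_of_zero[OF f S n dnz]) (simp add: dz, blast)
  have contf: "continuous_on S f"
    using f by (rule holomorphic_on_imp_continuous_on)
  \<comment> \<open>The denominator of the Cayley transform equals \<open>2 * c\<close> at
    \<open>z0\<close>; this is where \<open>f z0 \<noteq> 0\<close> enters.\<close>
  have "open {z \<in> S. f z + c \<noteq> 0}"
  proof -
    have "continuous_on S (\<lambda>z. f z + c)"
      using contf by (intro continuous_intros)
    then have "open (S \<inter> (\<lambda>z. f z + c) -` (- {0}))"
      using S(1) by (rule continuous_open_preimage) (simp add: open_Compl)
    moreover have "S \<inter> (\<lambda>z. f z + c) -` (- {0}) = {z \<in> S. f z + c \<noteq> 0}"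
      by auto
    ultimately show ?thesis
      by simp
  qed
  moreover have "z0 \<in> {z \<in> S. f z + c \<noteq> 0}"
    using S(2) nz by (simp add: c_def)
  ultimately obtain e2 where e2: "0 < e2" "ball z0 e2 \<subseteq> {z \<in> S. f z + c \<noteq> 0}"
    by (meson openE)
  define e where "e = min e1 e2"
  have e: "0 < e" "ball z0 e \<subseteq> ball z0 e1" "ball z0 e \<subseteq> S"
      "\<And>z. z \<in> ball z0 e \<Longrightarrow> f z + c \<noteq> 0"
    using g(1) e2 by (auto simp: e_def)
  have "(\<lambda>z. g z / (f z + c)) holomorphic_on ball z0 e"
    by (intro holomorphic_intros holomorphic_on_subset[OF g(2)] holomorphic_on_subset[OF f] e)
  moreover have "g z / (f z + c) \<noteq> 0" if "z \<in> ball z0 e" for z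
    using that e g(4) by auto
  ultimately obtain h where h: "h holomorphic_on ball z0 e"
      "\<And>z. z \<in> ball z0 e \<Longrightarrow> h z ^ n = g z / (f z + c)"
    using holomorphic_nth_root_ball[of "\<lambda>z. g z / (f z + c)" z0 e n] n by blast
  \<comment> \<open>The root is taken of the nonvanishing cofactor \<open>g / (f + c)\<close> alone,
    and \<open>z - z0\<close> serves as the root of \<open>(z - z0) ^ n\<close>. So \<open>v\<close>
    has a simple zero at \<open>z0\<close>, with derivative \<open>h z0\<close>, and is locally
    invertible.\<close>
  define v where "v = (\<lambda>z. (z - z0) * h z)"
  have v: "v holomorphic_on ball z0 e"
    unfolding v_def by (intro holomorphic_intros h)
  have v_eq: "v z ^ n * (f z + c) = f z - c" if "z \<in> ball z0 e" for z
    using that e g(3)[of z] h(2)[OF that] by (auto simp: v_def power_mult_distrib c_def)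
  have z0: "z0 \<in> ball z0 e"
    using e by simp
  have "h z0 \<noteq> 0"
    using h(2)[OF z0] g(4)[of z0] e(4)[OF z0] g(1) n by (auto simp: power_0_left)
  moreover have "deriv v z0 = h z0"
  proof (rule DERIV_imp_deriv)
    have "(h has_field_derivative deriv h z0) (at z0)"
      using h(1) z0 holomorphic_derivI by blast
    then show "(v has_field_derivative h z0) (at z0)"
      unfolding v_def by (auto intro!: derivative_eq_intros)
  qed
  ultimately obtain d where d: "0 < d" "ball z0 d \<subseteq> ball z0 e" "inj_on v (ball z0 d)"
    using has_complex_derivative_locally_injective[OF v z0 open_ball] by metis
  have v': "v holomorphic_on ball z0 d"
    using v d(2) by (rule holomorphic_on_subset)
  obtain \<phi> where \<phi>: "\<phi> holomorphic_on v ` ball z0 d" "\<And>z. z \<in> ball z0 d \<Longrightarrow> \<phi> (v z) = z"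
    using holomorphic_has_inverse[OF v' open_ball d(3)] by metis
  have "open (v ` ball z0 d)"
    using open_mapping_thm3[OF v' open_ball d(3)] .
  moreover have v0: "v z0 = 0"
    by (simp add: v_def)
  then have "0 \<in> v ` ball z0 d"
    using d(1) by (metis centre_in_ball image_eqI)
  ultimately obtain r where r: "0 < r" "ball 0 r \<subseteq> v ` ball z0 d"
    by (meson openE)
  have *: "\<phi> w \<in> ball z0 e" "v (\<phi> w) = w" if "w \<in> ball 0 r" for w
    using that r(2) \<phi>(2) d(2) by fastforce+
  show thesis
  proof
    show "sector_chart f S z0 n r \<phi>"
    proof
      show "continuous_on (ball 0 r) \<phi>"
        using \<phi>(1) r(2) holomorphic_on_imp_continuous_on continuous_on_subset by metis
      show "inj_on \<phi> (ball 0 r)"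
        using * by (metis inj_on_inverseI)
      show "\<phi> 0 = z0"
        using \<phi>(2)[of z0] d(1) v0 by simp
      fix w :: complex assume w: "w \<in> ball 0 r"
      show "\<phi> w \<in> S"
        using *(1)[OF w] e by auto
      have eq: "w ^ n * (f (\<phi> w) + c) = f (\<phi> w) - c"
        using v_eq[OF *(1)[OF w]] *(2)[OF w] by simp
      show "cmod (f (\<phi> w)) < cmod (f z0) \<longleftrightarrow> Re (w ^ n) < 0"
        using cmod_compare_Cayley(1)[OF eq e(4)[OF *(1)[OF w]]] by (simp add: c_def)
      show "cmod (f z0) < cmod (f (\<phi> w)) \<longleftrightarrow> 0 < Re (w ^ n)"
        using cmod_compare_Cayley(2)[OF eq e(4)[OF *(1)[OF w]]] by (simp add: c_def)
    qed (use n r in auto)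
  qed
qed

section \<open>Paths and powers in the coordinate plane\<close>

text \<open>Turning \<open>w\<close> by an angle divided by \<open>n\<close> turns
  \<open>w ^ n\<close> by the full angle. Here \<open>\<theta>\<close> is any argument of
  \<open>w ^ n\<close>, not necessarily the principal one, so the caller decides which way round the
  circle the power moves.\<close>

lemma rotation_path:
  assumes "0 < n" and w: "w ^ n = of_real (cmod w ^ n) * cis \<theta>"
  obtains p where "path p" "pathstart p = w" 
    "pathfinish p ^ n = of_real (cmod w ^ n) * cis \<theta>'"
    "\<And>z. z \<in> path_image p \<Longrightarrow> cmod z = cmod w"
    "\<And>z. z \<in> path_image p \<Longrightarrow>
       \<exists>t \<in> closed_segment \<theta> \<theta>'. z ^ n = of_real (cmod w ^ n) * cis t"
proof
  define p where "p = (\<lambda>s::real. w * cis (s * (\<theta>' - \<theta>) / n))"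
  have p_pow: "p s ^ n = of_real (cmod w ^ n) * cis (\<theta> + s * (\<theta>' - \<theta>))" for s
  proof -
    have "cis (s * (\<theta>' - \<theta>) / n) ^ n = cis (s * (\<theta>' - \<theta>))"
      using assms(1) by (simp add: Complex.DeMoivre)
    then show ?thesis
      unfolding p_def power_mult_distrib w by (simp only: mult.assoc cis_mult)
  qed
  show "path p"
    unfolding path_def p_def cis_conv_exp using assms(1) by (intro continuous_intros) auto
  show "pathstart p = w"
    by (simp add: pathstart_def p_def)
  show "pathfinish p ^ n = of_real (cmod w ^ n) * cis \<theta>'"
    by (simp add: pathfinish_def p_pow)
  fix z assume "z \<in> path_image p"
  then obtain s where s: "s \<in> {0..1}" "z = p s"
    by (auto simp: path_image_def)
  show "cmod z = cmod w"
    by (simp add: s p_def norm_mult)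
  show "\<exists>t \<in> closed_segment \<theta> \<theta>'. z ^ n = of_real (cmod w ^ n) * cis t"
  proof
    show "\<theta> + s * (\<theta>' - \<theta>) \<in> closed_segment \<theta> \<theta>'"
      using s(1) unfolding in_segment by (auto intro!: exI[of _ s] simp: algebra_simps)
    show "z ^ n = of_real (cmod w ^ n) * cis (\<theta> + s * (\<theta>' - \<theta>))"
      by (simp add: s p_pow)
  qed
qed

text \<open>The power map is open, and an open set cannot lie inside a half-line: shifting a point
  of the half-line slightly in the imaginary direction leaves it.\<close>

lemma open_power_not_nonpos_Real:
  fixes W :: "complex set"
  assumes "open W" "W \<noteq> {}" "0 < n"
  obtains w where "w \<in> W" "w ^ n \<notin> \<real>\<^sub>\<le>\<^sub>0"
proof -
  have "open ((\<lambda>w. w ^ n) ` W)"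
  proof (rule open_mapping_thm[of _ UNIV])
    show "\<not> (\<lambda>w::complex. w ^ n) constant_on UNIV"
      using assms(3) unfolding constant_on_def
      by (metis UNIV_I power_0_left power_one zero_neq_one not_gr_zero)
  qed (use assms in \<open>auto intro: holomorphic_intros\<close>)
  moreover obtain x where x: "x \<in> (\<lambda>w. w ^ n) ` W"
    using assms(2) by blast
  ultimately obtain e where e: "0 < e" "ball x e \<subseteq> (\<lambda>w. w ^ n) ` W"
    by (meson openE)
  define y where "y = x + \<i> * of_real (e / 2)"
  have "y \<in> ball x e"
    using e(1) by (simp add: y_def dist_norm norm_mult)
  then have y: "y \<in> (\<lambda>w. w ^ n) ` W"
    using e by blast
  have "x \<notin> \<real>\<^sub>\<le>\<^sub>0 \<or> y \<notin> \<real>\<^sub>\<le>\<^sub>0"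
    using e(1) by (auto simp: y_def complex_nonpos_Reals_iff)
  then show thesis
    using x y that by blast
qed

lemma pos_mult_cis_not_nonpos_Real:
  assumes "0 < R" "\<bar>t\<bar> < pi"
  shows "of_real R * cis t \<notin> \<real>\<^sub>\<le>\<^sub>0"
proof -
  have "t = 0" if "sin t = 0"
    using sin_eq_0_pi[OF _ _ that] assms(2) by linarith
  then show ?thesis
    using assms(1) by (auto simp: complex_nonpos_Reals_iff mult_le_0_iff)
qed

lemma closed_segment_0_power:
  fixes a :: complex
  assumes "w \<in> closed_segment 0 a" "a ^ n = - of_real R"
  obtains s where "0 \<le> s" "s \<le> 1" "w = of_real s * a" "w ^ n = - of_real (s ^ n * R)"
proof -
  obtain s where s: "0 \<le> s" "s \<le> 1" "w = of_real s * a"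
    using assms(1) by (auto simp: in_segment scaleR_conv_of_real)
  show thesis
    by (rule that[OF s]) (simp add: s power_mult_distrib assms(2))
qed

section \<open>Different sectors lie in different components\<close>

context sector_chart
begin

lemma open_image: "open W \<Longrightarrow> W \<subseteq> ball 0 r \<Longrightarrow> open (\<phi> ` W)"
  using cont inj by (metis continuous_on_subset inj_on_subset invariance_of_domain)

definition sublevel :: "complex set" where
  "sublevel = {z \<in> S. cmod (f z) < cmod (f z0)}"

lemma image_in_sublevel: "w \<in> ball 0 r \<Longrightarrow> Re (w ^ n) < 0 \<Longrightarrow> \<phi> w \<in> sublevel"
  using into less by (simp add: sublevel_def)

text \<open>The bound is the negation of \<open>greater\<close>. It cannot be strict, since the ray
  includes its endpoint \<open>0\<close>, which \<open>\<phi>\<close> sends to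
  \<open>z0\<close>.\<close>

lemma norm_le_ray:
  assumes "a \<in> ball 0 r" "a ^ n = - of_real R" "0 \<le> R" "w \<in> closed_segment 0 a"
  shows "w \<in> ball 0 r" "w ^ n \<in> \<real>\<^sub>\<le>\<^sub>0" "cmod (f (\<phi> w)) \<le> cmod (f z0)"
proof -
  obtain s where s: "0 \<le> s" "s \<le> 1" "w = of_real s * a" "w ^ n = - of_real (s ^ n * R)"
    using closed_segment_0_power[OF assms(4,2)] .
  have "0 \<le> s ^ n * R"
    using s assms by simp
  then show w: "w ^ n \<in> \<real>\<^sub>\<le>\<^sub>0"
    unfolding s(4) by (simp add: complex_nonpos_Reals_iff del: of_real_mult of_real_power)
  have "closed_segment 0 a \<subseteq> ball 0 r"
    using assms(1) r_pos by (intro closed_segment_subset) auto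
  then show "w \<in> ball 0 r"
    using assms(4) by blast
  then show "cmod (f (\<phi> w)) \<le> cmod (f z0)"
    using greater[of w] w by (auto simp: complex_nonpos_Reals_iff)
qed

text \<open>If one component met two different sectors, an arc in it could be closed up through \<open>z0\<close>
  to a Jordan curve on which \<open>cmod f \<le> cmod (f z0)\<close>. Near \<open>z0\<close> this curve consists of two of the
  rays \<open>w ^ n \<le> 0\<close>, so its interior, which accumulates at \<open>z0\<close>, contains a point with
  \<open>cmod f > cmod (f z0)\<close>, against the maximum principle.\<close>

lemma root_unique_in_component:
  assumes f: "f holomorphic_on S" and S: "open S" "simply_connected S"
    and R: "0 < R"
    and a: "a \<in> ball 0 r" "a ^ n = - of_real R"
    and b: "b \<in> ball 0 r" "b ^ n = - of_real R"
    and C: "C \<in> components sublevel" "\<phi> a \<in> C" "\<phi> b \<in> C"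
  shows "a = b"
proof (rule ccontr)
  assume ab: "a \<noteq> b"
  have contf: "continuous_on S f"
    using f by (rule holomorphic_on_imp_continuous_on)
  have "open sublevel"
  proof -
    have "open (S \<inter> f -` ball 0 (cmod (f z0)))"
      using contf S(1) by (simp add: continuous_open_preimage)
    moreover have "S \<inter> f -` ball 0 (cmod (f z0)) = sublevel"
      by (auto simp: sublevel_def)
    ultimately show ?thesis
      by simp
  qed
  then have openC: "open C"
    using C(1) open_components by blast
  have "path_connected C"
    using C(1) openC by (simp add: connected_open_path_connected in_components_connected)
  then obtain g where g: "path g" "path_image g \<subseteq> C" "pathstart g = \<phi> a" "pathfinish g = \<phi> b"
    using C by (metis path_connected_def)
  have Csub: "C \<subseteq> sublevel"
    using C(1) by (rule in_components_subset)
  have z0C: "z0 \<notin> C"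
    using Csub by (auto simp: sublevel_def)
  define Ia where "Ia = \<phi> ` closed_segment 0 a"
  define Ib where "Ib = \<phi> ` closed_segment 0 b"
  have sega: "closed_segment 0 a \<subseteq> ball 0 r" and segb: "closed_segment 0 b \<subseteq> ball 0 r"
    using norm_le_ray(1)[OF a] norm_le_ray(1)[OF b] R by auto
  have "compact Ia" "compact Ib"
    unfolding Ia_def Ib_def
    by (intro compact_continuous_image continuous_on_subset[OF cont] sega segb compact_segment)+
  then have closed: "closed Ia" "closed Ib"
    by (simp_all add: compact_imp_closed)
  have IaIb: "Ia \<inter> Ib \<subseteq> {z0}"
  proof
    fix x assume "x \<in> Ia \<inter> Ib"
    then obtain w w' where "w \<in> closed_segment 0 a" "w' \<in> closed_segment 0 b" "x = \<phi> w" "x = \<phi> w'"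
      by (auto simp: Ia_def Ib_def)
    moreover from this have "w = w'"
      using inj sega segb by (metis inj_onD subsetD)
    ultimately have w: "w \<in> closed_segment 0 a" "w \<in> closed_segment 0 b" "x = \<phi> w"
      by auto
    obtain s where s: "0 \<le> s" "w = of_real s * a" "w ^ n = - of_real (s ^ n * R)"
      using closed_segment_0_power[OF w(1) a(2)] by metis
    obtain t where t: "0 \<le> t" "w = of_real t * b" "w ^ n = - of_real (t ^ n * R)"
      using closed_segment_0_power[OF w(2) b(2)] by metis
    \<comment> \<open>Equal \<open>n\<close>-th powers force equal parameters on the two rays, and a
      common parameter with \<open>a \<noteq> b\<close> can only be \<open>0\<close>.\<close>
    have "s ^ n * R = t ^ n * R"
      using s(3) t(3) by (metis neg_equal_iff_equal of_real_eq_iff)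
    then have "s = t"
      using R s(1) t(1) n_pos by (simp add: power_eq_iff_eq_base)
    then have "s = 0"
      using s(2) t(2) ab by auto
    then show "x \<in> {z0}"
      using s w zero by simp
  qed
  have aIa: "\<phi> a \<in> Ia" and bIb: "\<phi> b \<in> Ib"
    by (auto simp: Ia_def Ib_def)
  \<comment> \<open>The path \<open>g\<close> may cross both rays many times. It is cut where it
    first hits \<open>Ib\<close>, giving \<open>h1\<close>; then \<open>h1\<close> is run backwards
    until it hits \<open>Ia\<close>, giving \<open>h2\<close>. So \<open>h2\<close> meets
    \<open>Ib\<close> only at its start and \<open>Ia\<close> only at its end. These endpoints
    replace \<open>\<phi> b\<close> and \<open>\<phi> a\<close>, and the rays are shortened to
    them.\<close>
  have "\<phi> a \<notin> Ib"
    using aIa IaIb C z0C by auto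
  then have "pathstart g \<in> closure (- Ib)" "pathfinish g \<notin> - Ib"
    using g bIb closure_subset[of "- Ib"] by auto
  then obtain h1 where h1: "path h1" "pathstart h1 = \<phi> a" "path_image h1 \<subseteq> path_image g"
      "path_image h1 - {pathfinish h1} \<subseteq> interior (- Ib)" "pathfinish h1 \<in> frontier (- Ib)"
    using exists_path_subpath_to_frontier[OF g(1)] g(3) by metis
  have finh1: "pathfinish h1 \<in> Ib"
    using h1(5) closed by (metis frontier_complement frontier_subset_closed subsetD)
  have h1C: "path_image h1 \<subseteq> C"
    using h1 g by blast
  have "pathfinish h1 \<in> C"
    using h1C pathfinish_in_path_image by blast
  then have "pathfinish h1 \<notin> Ia"
    using finh1 IaIb z0C by blast
  then have "pathstart (reversepath h1) \<in> closure (- Ia)" "pathfinish (reversepath h1) \<notin> - Ia"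
    using h1 aIa closure_subset[of "- Ia"] by auto
  then obtain h2 where h2: "path h2" "pathstart h2 = pathfinish h1" "path_image h2 \<subseteq> path_image h1"
      "path_image h2 - {pathfinish h2} \<subseteq> interior (- Ia)" "pathfinish h2 \<in> frontier (- Ia)"
    using exists_path_subpath_to_frontier[of "reversepath h1" "- Ia"] h1(1)
    by (metis path_image_reversepath path_reversepath pathstart_reversepath)
  have finh2: "pathfinish h2 \<in> Ia"
    using h2(5) closed by (metis frontier_complement frontier_subset_closed subsetD)
  have h2C: "path_image h2 \<subseteq> C"
    using h2 h1C by blast
  have finh2C: "pathfinish h2 \<in> C"
    using h2C pathfinish_in_path_image by blast
  obtain a' where a': "a' \<in> closed_segment 0 a" "pathfinish h2 = \<phi> a'"
    using finh2 by (auto simp: Ia_def)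
  obtain b' where b': "b' \<in> closed_segment 0 b" "pathfinish h1 = \<phi> b'"
    using finh1 by (auto simp: Ib_def)
  have "\<phi> b' \<noteq> \<phi> a'"
    using a' b' finh1 finh2 finh2C IaIb z0C by auto
  \<comment> \<open>A Jordan curve needs an arc, and \<open>h2\<close> may still cross itself.
    Passing to a smaller image keeps the control over intersections with the rays.\<close>
  then obtain k where k: "arc k" "path_image k \<subseteq> path_image h2" 
      "pathstart k = \<phi> b'" "pathfinish k = \<phi> a'"
    using path_contains_arc[of h2 "\<phi> b'" "\<phi> a'"] h2 a' b' by metis
  have kI: "path_image k \<inter> (Ia \<union> Ib) \<subseteq> {\<phi> a', \<phi> b'}"
    using k(2) h2(3,4) h1(4) a' b' interior_subset by blast
  have kC: "path_image k \<subseteq> C"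
    using k h2C by blast
  have ne0: "a' \<noteq> 0" "b' \<noteq> 0"
    using \<open>pathfinish h1 \<in> C\<close> finh2C a' b' zero z0C by auto
  have sega': "closed_segment 0 a' \<subseteq> closed_segment 0 a"
    and segb': "closed_segment 0 b' \<subseteq> closed_segment 0 b"
    using a' b' by (auto simp: subset_closed_segment)
  define l1 where "l1 = \<phi> \<circ> linepath a' 0"
  define l2 where "l2 = \<phi> \<circ> linepath 0 b'"
  have im_l1: "path_image l1 \<subseteq> Ia" and im_l2: "path_image l2 \<subseteq> Ib"
    using sega' segb' by (auto simp: l1_def l2_def path_image_compose Ia_def Ib_def closed_segment_commute)
  have l1: "arc l1" unfolding l1_def
  proof (rule arc_inj_continuous_image)
    show "arc (linepath a' 0)" using ne0 by simp
    have "path_image (linepath a' 0) \<subseteq> ball 0 r"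
      using sega sega' by (auto simp: closed_segment_commute)
    then show "continuous_on (path_image (linepath a' 0)) \<phi>" "inj_on \<phi> (path_image (linepath a' 0))"
      using cont inj by (auto intro: continuous_on_subset inj_on_subset)
  qed
  have l2: "arc l2" unfolding l2_def
  proof (rule arc_inj_continuous_image)
    show "arc (linepath 0 b')" using ne0 by simp
    have "path_image (linepath 0 b') \<subseteq> ball 0 r"
      using segb segb' by auto
    then show "continuous_on (path_image (linepath 0 b')) \<phi>" "inj_on \<phi> (path_image (linepath 0 b'))"
      using cont inj by (auto intro: continuous_on_subset inj_on_subset)
  qed
  have ends: "pathstart l1 = \<phi> a'" "pathfinish l1 = z0" "pathstart l2 = z0" "pathfinish l2 = \<phi> b'"
    by (simp_all add: l1_def l2_def pathstart_compose pathfinish_compose zero)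
  have l12: "arc (l1 +++ l2)"
    using l1 l2 ends im_l1 im_l2 IaIb by (intro arc_join) auto
  have im_l12: "path_image (l1 +++ l2) \<subseteq> Ia \<union> Ib"
    using im_l1 im_l2 ends by (auto simp: path_image_join)
  define J where "J = path_image ((l1 +++ l2) +++ k)"
  have sJ: "simple_path ((l1 +++ l2) +++ k)"
    using l12 k ends im_l12 kI by (intro simple_path_join_loop) auto
  have J_eq: "J = path_image (l1 +++ l2) \<union> path_image k"
    unfolding J_def using k ends by (intro path_image_join) auto
  have z0J: "z0 \<in> J"
    using ends pathstart_in_path_image[of l2] by (auto simp: J_eq path_image_join)
  have le: "cmod (f x) \<le> cmod (f z0)" and JS: "x \<in> S" if "x \<in> J" for x
  proof -
    have "x \<in> Ia \<union> Ib \<union> C"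
      using that J_eq im_l12 kC by blast
    moreover have "cmod (f x) \<le> cmod (f z0) \<and> x \<in> S" if "x \<in> Ia"
      using that norm_le_ray[OF a] R into by (auto simp: Ia_def)
    moreover have "cmod (f x) \<le> cmod (f z0) \<and> x \<in> S" if "x \<in> Ib"
      using that norm_le_ray[OF b] R into by (auto simp: Ib_def)
    moreover have "cmod (f x) \<le> cmod (f z0) \<and> x \<in> S" if "x \<in> C"
      using that Csub by (auto simp: sublevel_def)
    ultimately show "cmod (f x) \<le> cmod (f z0)" "x \<in> S"
      by blast+
  qed
  define I where "I = inside J"
  have "pathfinish ((l1 +++ l2) +++ k) = pathstart ((l1 +++ l2) +++ k)"
    using k ends by simp
  from Jordan_inside_outside[OF sJ this]
  have I: "open I" "bounded I" "frontier I = J" "I \<inter> outside J = {}" "I \<union> outside J = - J"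
      "open (outside J)"
    by (simp_all add: I_def J_def)
  \<comment> \<open>Simple connectivity of \<open>S\<close> is used here: no hole of
    \<open>S\<close> can sit inside \<open>J\<close>.\<close>
  have IS: "I \<subseteq> S"
    unfolding I_def using S JS by (intro subset_simply_connected_imp_inside_subset) auto
  have max: "cmod (f x) \<le> cmod (f z0)" if "x \<in> I" for x
  proof (rule maximum_modulus_frontier[of f I])
    show "f holomorphic_on interior I"
      using f IS interior_subset by (meson holomorphic_on_subset subset_trans)
    have "closure I \<subseteq> S"
      using IS I(3) JS by (auto simp: closure_Un_frontier)
    then show "continuous_on (closure I) f"
      using contf continuous_on_subset by blast
  qed (use I le that in auto)
  \<comment> \<open>The image of \<open>k\<close> is closed and lies in \<open>C\<close>, which
    omits \<open>z0\<close>. So a small disk around \<open>0\<close> sees nothing of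
    \<open>J\<close> except the two rays.\<close>
  have "open (ball 0 r \<inter> \<phi> -` (- path_image k))"
    using cont k(1) by (intro continuous_open_preimage) (auto simp: closed_arc_image)
  moreover have "0 \<in> ball 0 r \<inter> \<phi> -` (- path_image k)"
    using r_pos kC z0C zero by auto
  ultimately obtain \<delta> where \<delta>: "0 < \<delta>" "ball 0 \<delta> \<subseteq> ball 0 r \<inter> \<phi> -` (- path_image k)"
    by (meson openE)
  have \<delta>r: "ball (0::complex) \<delta> \<subseteq> ball 0 r"
    using \<delta> by blast
  have notJ: "\<phi> w \<notin> J" if "w \<in> ball 0 \<delta>" "w ^ n \<notin> \<real>\<^sub>\<le>\<^sub>0" for w
  proof
    assume "\<phi> w \<in> J"
    moreover have "\<phi> w \<notin> path_image k"
      using \<delta> that by blast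
    ultimately obtain w' where w': "w' \<in> closed_segment 0 a \<union> closed_segment 0 b" "\<phi> w = \<phi> w'"
      using im_l12 by (auto simp: J_eq Ia_def Ib_def)
    moreover have "w \<in> ball 0 r" "w' \<in> ball 0 r"
      using that(1) \<delta>r w'(1) sega segb by blast+
    ultimately have "w \<in> closed_segment 0 a \<union> closed_segment 0 b"
      using inj by (metis inj_onD)
    then show False
      using norm_le_ray(2)[OF a] norm_le_ray(2)[OF b] R that(2) by auto
  qed
  define W where "W = ball 0 \<delta> \<inter> \<phi> -` I"
  have "open W"
    unfolding W_def using \<delta>r cont I(1) by (intro continuous_open_preimage) (auto intro: continuous_on_subset)
  \<comment> \<open>\<open>z0\<close> lies on \<open>J\<close>, which by the Jordan curve theorem is
    the whole frontier of \<open>I\<close>.\<close>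
  moreover have "W \<noteq> {}"
  proof -
    have "open (\<phi> ` ball 0 \<delta>)"
      using \<delta>r by (intro open_image) auto
    moreover have "z0 \<in> \<phi> ` ball 0 \<delta>"
      using zero \<delta>(1) by (auto intro!: image_eqI[of _ _ 0])
    moreover have "z0 \<in> closure I"
      using z0J I(3) by (simp add: closure_Un_frontier)
    ultimately have "\<phi> ` ball 0 \<delta> \<inter> I \<noteq> {}"
      using open_Int_closure_eq_empty by blast
    then show ?thesis
      by (auto simp: W_def)
  qed
  ultimately obtain w where w: "w \<in> W" "w ^ n \<notin> \<real>\<^sub>\<le>\<^sub>0"
    using n_pos open_power_not_nonpos_Real by metis
  have w_pow: "w ^ n = of_real (cmod w ^ n) * cis (Arg (w ^ n))"
    by (metis norm_power rcis_cmod_Arg rcis_def)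
  have wn0: "w ^ n \<noteq> 0"
    using w(2) by (metis nonpos_Reals_zero_I)
  have Argw: "\<bar>Arg (w ^ n)\<bar> < pi"
  proof -
    have "Arg (w ^ n) \<noteq> pi"
      using w(2) by (metis Arg_eq_pi complex_nonpos_Reals_iff less_imp_le)
    then show ?thesis
      using mpi_less_Arg[of "w ^ n"] Arg_le_pi[of "w ^ n"] by linarith
  qed
  \<comment> \<open>The point \<open>\<phi> w\<close> lies in \<open>I\<close>, but
    \<open>w ^ n\<close> need not have positive real part. Turning the power to angle
    \<open>0\<close> keeps the angle strictly between \<open>-pi\<close> and \<open>pi\<close>, so
    the image path never meets \<open>J\<close> and stays in \<open>I\<close>; it ends where
    \<open>cmod f\<close> exceeds \<open>cmod (f z0)\<close>.\<close>
  obtain p where p: "path p" "pathstart p = w" "pathfinish p ^ n = of_real (cmod w ^ n) * cis 0"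
    "\<And>z. z \<in> path_image p \<Longrightarrow> cmod z = cmod w"
    "\<And>z. z \<in> path_image p \<Longrightarrow>
       \<exists>t \<in> closed_segment (Arg (w ^ n)) 0. z ^ n = of_real (cmod w ^ n) * cis t"
    using rotation_path[OF n_pos w_pow, of 0] by metis
  have p\<delta>: "path_image p \<subseteq> ball 0 \<delta>"
    using p(4) w by (auto simp: W_def)
  have p_pow: "z ^ n \<notin> \<real>\<^sub>\<le>\<^sub>0" if "z \<in> path_image p" for z
  proof -
    obtain t where t: "t \<in> closed_segment (Arg (w ^ n)) 0" "z ^ n = of_real (cmod w ^ n) * cis t"
      using p(5) \<open>z \<in> path_image p\<close> by blast
    have "\<bar>t\<bar> < pi"
      using t(1) Argw by (auto simp: closed_segment_eq_real_ivl split: if_splits)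
    moreover have "w \<noteq> 0"
      using wn0 n_pos by auto
    then have "0 < cmod w ^ n"
      by simp
    ultimately show ?thesis
      unfolding t(2) by (intro pos_mult_cis_not_nonpos_Real)
  qed
  define M where "M = \<phi> ` path_image p"
  have "connected M"
    unfolding M_def using p(1) p\<delta> \<delta>r cont
    by (intro connected_continuous_image connected_path_image) (auto intro: continuous_on_subset)
  moreover have "M \<subseteq> - J"
    using notJ p_pow p\<delta> by (auto simp: M_def)
  moreover have "\<phi> w \<in> M \<inter> I"
    using w p(2) pathstart_in_path_image[of p] by (auto simp: M_def W_def)
  ultimately have "M \<inter> outside J = {}"
    using I connectedD[of M I "outside J"] by blast
  then have "M \<subseteq> I"
    using I \<open>M \<subseteq> - J\<close> by blast
  then have "\<phi> (pathfinish p) \<in> I"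
    by (auto simp: M_def)
  moreover have "pathfinish p \<in> ball 0 r"
    using p\<delta> \<delta>r pathfinish_in_path_image by blast
  moreover have "Re (pathfinish p ^ n) > 0"
    using p(3) wn0 n_pos by (auto simp flip: of_real_power)
  ultimately show False
    using max greater by fastforce
qed

section \<open>Components touching \<open>z0\<close> and the roots marking the sectors\<close>

text \<open>A component that accumulates at \<open>z0\<close> enters some sector. Inside that sector
  any point can be joined to the marking root by a rotation onto the central ray followed by a
  radial move to radius \<open>\<rho>\<close>.\<close>

lemma component_contains_root:
  assumes C: "C \<in> components sublevel" "z0 \<in> closure C" and \<rho>: "0 < \<rho>" "\<rho> < r"
  obtains a where "a ^ n = - of_real (\<rho> ^ n)" "cmod a = \<rho>" "\<phi> a \<in> C"
proof -
  have "open (\<phi> ` ball 0 \<rho>)"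
    using \<rho> by (intro open_image) auto
  moreover have "z0 \<in> \<phi> ` ball 0 \<rho>"
    using zero \<rho>(1) by (auto intro!: image_eqI[of _ _ 0])
  ultimately have "\<phi> ` ball 0 \<rho> \<inter> C \<noteq> {}"
    using C(2) open_Int_closure_eq_empty by blast
  then obtain w where w: "w \<in> ball 0 \<rho>" "\<phi> w \<in> C"
    by blast
  have wr: "w \<in> ball 0 r"
    using w \<rho> by auto
  have "\<phi> w \<in> sublevel"
    using C(1) w(2) in_components_subset by blast
  then have neg: "Re (w ^ n) < 0"
    using less[OF wr] by (simp add: sublevel_def)
  then have wn0: "w ^ n \<noteq> 0"
    by auto
  then have w0: "cmod w > 0"
    using n_pos by auto
  \<comment> \<open>The argument is measured around \<open>pi\<close>. With the principal value of
    \<open>w ^ n\<close>, which may be close to \<open>-pi\<close>, the rotation to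
    \<open>pi\<close> would sweep through the right half plane.\<close>
  define \<theta> where "\<theta> = Arg (- (w ^ n)) + pi"
  have \<theta>: "\<bar>\<theta> - pi\<bar> < pi / 2"
    using Re_Ln_pos_lt[of "- (w ^ n)"] neg wn0 by (simp add: \<theta>_def Arg_eq_Im_Ln)
  have "- (w ^ n) = of_real (cmod w ^ n) * cis (Arg (- (w ^ n)))"
    by (metis norm_minus_cancel norm_power rcis_cmod_Arg rcis_def)
  then have w_pow: "w ^ n = of_real (cmod w ^ n) * cis \<theta>"
    unfolding \<theta>_def cis_mult[symmetric] by (metis cis_pi minus_minus mult.assoc mult_minus1_right)
  obtain p where p: "path p" "pathstart p = w" "pathfinish p ^ n = of_real (cmod w ^ n) * cis pi"
    "\<And>z. z \<in> path_image p \<Longrightarrow> cmod z = cmod w"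
    "\<And>z. z \<in> path_image p \<Longrightarrow>
       \<exists>t \<in> closed_segment \<theta> pi. z ^ n = of_real (cmod w ^ n) * cis t"
    using rotation_path[OF n_pos w_pow, of pi] by metis
  define w' where "w' = pathfinish p"
  have w': "cmod w' = cmod w" "w' ^ n = - of_real (cmod w ^ n)"
    using p(3,4) pathfinish_in_path_image[of p] by (auto simp: w'_def)
  define a where "a = of_real (\<rho> / cmod w) * w'"
  have a: "a ^ n = - of_real (\<rho> ^ n)" "cmod a = \<rho>"
    using w0 w' \<rho> by (simp_all add: a_def power_mult_distrib power_divide norm_mult norm_divide)
  define K where "K = path_image p \<union> closed_segment w' a"
  have K: "z \<in> ball 0 r \<and> Re (z ^ n) < 0" if "z \<in> K" for z
    using that unfolding K_def
  proof
    assume z: "z \<in> path_image p"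
    then obtain t where t: "t \<in> closed_segment \<theta> pi" "z ^ n = of_real (cmod w ^ n) * cis t"
      using p(5) by blast
    have "\<bar>t - pi\<bar> < pi / 2"
      using t(1) \<theta> by (auto simp: closed_segment_eq_real_ivl split: if_splits)
    then have "cos (t - pi) > 0"
      by (intro cos_gt_zero_pi) linarith+
    then have "cos t < 0"
      by (simp add: cos_diff)
    then show ?thesis
      using z p(4)[OF z] wr t(2) w0 by (auto simp: mult_less_0_iff simp flip: of_real_power)
  next
    assume z: "z \<in> closed_segment w' a"
    have "closed_segment w' a \<subseteq> ball 0 r"
      using a w' wr \<rho> by (intro closed_segment_subset) auto
    then have "z \<in> ball 0 r"
      using z by blast
    moreover obtain u where u: "0 \<le> u" "u \<le> 1" "z = (1 - u) *\<^sub>R w' + u *\<^sub>R a"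
      using z by (auto simp: in_segment)
    \<comment> \<open>Both ends of the segment are positive multiples of \<open>w'\<close>, hence so
      is every point on it.\<close>
    define s where "s = (1 - u) + u * (\<rho> / cmod w)"
    have "z = of_real s * w'"
      by (simp add: u s_def a_def scaleR_conv_of_real algebra_simps)
    moreover have "s > 0"
    proof (cases "u = 0")
      case False
      then have "u * (\<rho> / cmod w) > 0"
        using u w0 \<rho> by (intro mult_pos_pos) auto
      then show ?thesis
        using u by (simp add: s_def)
    qed (simp add: s_def)
    ultimately show ?thesis
      using w0 w'(2) by (simp add: power_mult_distrib flip: of_real_power)
  qed
  have "connected K"
    unfolding K_def using p(1) pathfinish_in_path_image[of p]
    by (intro connected_Un connected_path_image) (auto simp: w'_def)
  moreover have "continuous_on K \<phi>"
    using K cont by (metis continuous_on_subset subsetI)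
  ultimately have "connected (\<phi> ` K)"
    using connected_continuous_image by blast
  moreover have "\<phi> ` K \<subseteq> sublevel"
    using K image_in_sublevel by blast
  moreover have "\<phi> w \<in> C \<inter> \<phi> ` K"
    using w p(2) pathstart_in_path_image[of p] by (auto simp: K_def)
  ultimately have "\<phi> ` K \<subseteq> C"
    using components_maximal[OF C(1)] by blast
  then have "\<phi> a \<in> C"
    by (auto simp: K_def)
  then show thesis
    using a that by blast
qed

text \<open>The half-open ray from \<open>\<phi> a\<close> towards \<open>z0\<close> is connected,
  stays in the sublevel set and accumulates at \<open>z0\<close>, while \<open>z0\<close> itself
  fails the strict inequality.\<close>

lemma root_component:
  assumes R: "0 < R" and a: "a \<in> ball 0 r" "a ^ n = - of_real R"
  shows "connected_component_set sublevel (\<phi> a) \<in> components sublevel"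
    and "z0 \<in> frontier (connected_component_set sublevel (\<phi> a))"
    and "\<phi> a \<in> connected_component_set sublevel (\<phi> a)"
proof -
  let ?C = "connected_component_set sublevel (\<phi> a)"
  have in_sub: "\<phi> a \<in> sublevel"
    using a R by (intro image_in_sublevel) auto
  then show "?C \<in> components sublevel"
    by (simp add: componentsI)
  show "\<phi> a \<in> ?C"
    using in_sub by simp
  define \<psi> where "\<psi> = (\<lambda>s::real. \<phi> (of_real s * a))"
  have seg: "of_real s * a \<in> closed_segment 0 a" if "s \<in> {0..1}" for s
    using that by (auto simp: in_segment scaleR_conv_of_real)
  have cont\<psi>: "continuous_on {0..1} \<psi>"
    unfolding \<psi>_def using norm_le_ray(1)[OF a] R seg
    by (intro continuous_on_compose2[OF cont] continuous_intros) auto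
  have "\<psi> ` {0<..1} \<subseteq> ?C"
  proof (rule connected_component_maximal)
    show "\<phi> a \<in> \<psi> ` {0<..1}"
      by (auto simp: \<psi>_def intro!: image_eqI[of _ _ 1])
    show "connected (\<psi> ` {0<..1})"
      using cont\<psi> by (intro connected_continuous_image) (auto intro: continuous_on_subset)
    show "\<psi> ` {0<..1} \<subseteq> sublevel"
    proof clarify
      fix s :: real assume s: "s \<in> {0<..1}"
      have "of_real s * a \<in> ball 0 r"
        using s seg norm_le_ray(1)[OF a] R by auto
      moreover have "Re ((of_real s * a) ^ n) < 0"
        using s R by (simp add: power_mult_distrib a(2) flip: of_real_power)
      ultimately show "\<psi> s \<in> sublevel"
        unfolding \<psi>_def by (rule image_in_sublevel)
    qed
  qed
  moreover have "z0 \<in> closure (\<psi> ` {0<..1})"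
  proof -
    have "\<psi> ` closure {0<..1} \<subseteq> closure (\<psi> ` {0<..1})"
      using cont\<psi> by (intro image_closure_subset) (auto simp: closure_subset[THEN subsetD])
    moreover have "\<psi> 0 = z0"
      by (simp add: \<psi>_def zero)
    ultimately show ?thesis
      by (metis (no_types, lifting) atLeastAtMost_iff closure_greaterThanAtMost image_eqI le_numeral_extra(3) subsetD zero_less_one zero_le_one)
  qed
  ultimately have "z0 \<in> closure ?C"
    using closure_mono by blast
  moreover have "z0 \<notin> ?C"
    using connected_component_subset[of sublevel "\<phi> a"] by (auto simp: sublevel_def)
  ultimately show "z0 \<in> frontier ?C"
    by (metis DiffI frontier_def interior_subset subsetD)
qed

section \<open>The count, and its application to Blaschke products\<close>

text \<open>Sending a root to its component is a bijection: \<open>root_unique_in_component\<close>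
  makes it injective, \<open>component_contains_root\<close> makes it surjective.\<close>

lemma ecard_components_at:
  assumes f: "f holomorphic_on S" and S: "open S" "simply_connected S"
  shows "ecard {C \<in> components sublevel. z0 \<in> frontier C} = enat n"
proof -
  \<comment> \<open>Any radius strictly between \<open>0\<close> and \<open>r\<close> would
    do.\<close>
  define \<rho> where "\<rho> = r / 2"
  have \<rho>: "0 < \<rho>" "\<rho> < r"
    using r_pos by (auto simp: \<rho>_def)
  define A where "A = {a::complex. a ^ n = - of_real (\<rho> ^ n)}"
  have cardA: "card A = n" "finite A"
    unfolding A_def using \<rho> n_pos by (auto intro!: card_nth_roots)
  have A: "a \<in> ball 0 r" "a ^ n = - of_real (\<rho> ^ n)" if "a \<in> A" for a
  proof -
    show eq: "a ^ n = - of_real (\<rho> ^ n)"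
      using that by (simp add: A_def)
    have "cmod a ^ n = \<rho> ^ n"
      using eq \<rho> by (metis abs_of_pos norm_minus_cancel norm_of_real norm_power zero_less_power)
    then have "cmod a = \<rho>"
      using \<rho> n_pos by (simp add: power_eq_iff_eq_base)
    then show "a \<in> ball 0 r"
      using \<rho> by simp
  qed
  have R: "0 < \<rho> ^ n"
    using \<rho> by simp
  define F where "F a = connected_component_set sublevel (\<phi> a)" for a
  note F = root_component[OF R A, folded F_def]
  have "inj_on F A"
  proof (rule inj_onI)
    fix a b assume "a \<in> A" "b \<in> A" "F a = F b"
    then show "a = b"
      using root_unique_in_component[OF f S R A A, of a b "F a"] F by metis
  qed
  moreover have "F ` A = {C \<in> components sublevel. z0 \<in> frontier C}"
  proof (intro equalityI subsetI)
    fix C assume "C \<in> {C \<in> components sublevel. z0 \<in> frontier C}"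
    then have C: "C \<in> components sublevel" "z0 \<in> closure C"
      by (auto simp: frontier_def)
    then obtain a where a: "a ^ n = - of_real (\<rho> ^ n)" "\<phi> a \<in> C"
      using component_contains_root[OF C \<rho>] by metis
    have "a \<in> A"
      using a by (simp add: A_def)
    moreover have "C = F a"
      using C(1) a(2) F(1,3)[OF \<open>a \<in> A\<close> \<open>a \<in> A\<close>] components_nonoverlap by blast
    ultimately show "C \<in> F ` A"
      by blast
  qed (use F in auto)
  ultimately show ?thesis
    using cardA by (metis card_image ecard_def finite_imageI)
qed

end

corollary ecard_components_sublevel:
  assumes f: "f holomorphic_on S" and S: "open S" "simply_connected S" "z0 \<in> S"
    and crit: "critical_point_of_order f z0 (n - 1)" and n: "1 \<le> n" and nz: "f z0 \<noteq> 0"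
  shows "ecard {C \<in> components {z \<in> S. cmod (f z) < cmod (f z0)}. z0 \<in> frontier C} = enat n"
proof -
  have "(deriv ^^ n) f z0 \<noteq> 0" "\<And>k. 0 < k \<Longrightarrow> k < n \<Longrightarrow> (deriv ^^ k) f z0 = 0"
    using crit n by (auto simp: critical_point_of_order_def simp del: funpow.simps)
  then obtain r \<phi> where "sector_chart f S z0 n r \<phi>"
    using sector_chart_exists[OF f S(1,3) nz] n by (metis less_le_trans zero_less_one)
  then interpret sector_chart f S z0 n r \<phi> .
  show ?thesis
    using ecard_components_at[OF f S(1,2)] by (simp add: sublevel_def)
qed

text \<open>If every derivative of positive order vanished at \<open>z0\<close>, the identity
  theorem would make \<open>f\<close> constant. This guarantees that the count applies and is at
  least \<open>1\<close>.\<close>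

lemma critical_point_of_order_exists:
  assumes f: "f holomorphic_on S" and S: "open S" "connected S" "z0 \<in> S"
    and nonconst: "\<not> f constant_on S"
  obtains n where "1 \<le> n" "critical_point_of_order f z0 (n - 1)"
proof -
  have ex: "\<exists>n. 0 < n \<and> (deriv ^^ n) f z0 \<noteq> 0"
  proof (rule ccontr)
    assume "\<not> ?thesis"
    then have "f w = f z0" if "w \<in> S" for w
      using holomorphic_fun_eq_const_on_connected[OF f S(1,2) _ S(3) that] by blast
    then show False
      using nonconst by (auto simp: constant_on_def)
  qed
  define n where "n = (LEAST n. 0 < n \<and> (deriv ^^ n) f z0 \<noteq> 0)"
  have n: "0 < n" "(deriv ^^ n) f z0 \<noteq> 0"
    using LeastI_ex[OF ex] by (auto simp: n_def)
  moreover have "(deriv ^^ k) f z0 = 0" if "0 < k" "k < n" for k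
    using not_less_Least[of k "\<lambda>n. 0 < n \<and> (deriv ^^ n) f z0 \<noteq> 0"] that by (auto simp: n_def)
  ultimately have "critical_point_of_order f z0 (n - 1)"
    by (auto simp: critical_point_of_order_def simp del: funpow.simps)
  then show thesis
    using n that[of n] by simp
qed

theorem theorem3p4:
  fixes B :: "complex \<Rightarrow> complex" and z0 :: complex
  assumes "blaschke_product B"
    and "property_B B"
    and "z0 \<in> ball 0 1"
  shows "\<exists>m::enat.
      ecard {C \<in> components (sublevel_set B (cmod (B z0))). z0 \<in> frontier C} = m \<and>
      (\<not> B constant_on ball 0 1 \<and> B z0 \<noteq> 0 \<longrightarrow> m \<ge> 1) \<and>
      (\<forall>n::nat. n \<ge> 1 \<and> critical_point_of_order B z0 (n - 1) \<and> B z0 \<noteq> 0 \<longrightarrow> enat n = m)"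
proof -
  let ?m = "ecard {C \<in> components (sublevel_set B (cmod (B z0))). z0 \<in> frontier C}"
  have hol: "B holomorphic_on ball 0 1"
    using assms(1) by (simp add: blaschke_product_def inner_function_def)
  have count: "?m = enat n" if "1 \<le> n" "critical_point_of_order B z0 (n - 1)" "B z0 \<noteq> 0" for n
    unfolding sublevel_set_def using hol that assms(3)
    by (intro ecard_components_sublevel) (auto simp: convex_imp_simply_connected)
  \<comment> \<open>Without nonconstancy this fails: a constant \<open>B\<close> has an empty
    sublevel set.\<close>
  have "1 \<le> ?m" if nonconst: "\<not> B constant_on ball 0 1" and nz: "B z0 \<noteq> 0"
  proof -
    obtain n where n: "1 \<le> n" "critical_point_of_order B z0 (n - 1)"
      using critical_point_of_order_exists[OF hol open_ball connected_ball assms(3) nonconst] by blast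
    show ?thesis
      unfolding count[OF n nz] using n(1) by (simp add: one_enat_def)
  qed
  then show ?thesis
    using count by auto
qed

end
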